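(* Let $q_\eta$, $\eta\in\Omega$, be the regular minimal exponential family $q_\eta(x)=h(x)\exp(\eta^{\mathsf T}T(x)-A(\eta))$ on $M$. Suppose that, for every $\eta$ under consideration and every $j=1,\dots,r$, there exists an admissible vector field $\psi^\eta_j$ satisfying $$\mathcal T_{q_\eta}\psi^\eta_j=-(T_j-m_j(\eta)).$$ Let a covector $\beta=\sum_j\beta_j\,dm_j$ in expectation coordinates determine the vector field $$v^\eta_\beta=-\sum_{j=1}^r\beta_j\psi^\eta_j .$$ Then the continuity equation $\partial_tq=-\operatorname{div}(q\,v^\eta_\beta)$ (for curves $q=q_{\eta_t}$ in the family) agrees exactly with natural parameter descent $\dot\eta=-\beta$. Consequently, its expectation coordinate satisfies Fisher mirror descent $$\dot m=-C(\eta)\beta .$$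
   Context: $M$ is a connected, closed, oriented Riemannian manifold with metric $g$ and volume $\mathrm{vol}$. $T=(T_1,\dots,T_r):M\to\mathbf R^r$ is smooth, $h$ is a positive smooth reference density, $\Omega\subset\mathbf R^r$ is open, $A(\eta)=\log\int_M h\,e^{\eta^{\mathsf T}T}\,d\mathrm{vol}$, $m(\eta)=\mathbf E_{q_\eta}[T]=\nabla_\eta A(\eta)$ (expectation coordinate), $C(\eta)=\mathrm{Cov}_{q_\eta}(T)=\nabla^2_\eta A(\eta)$; minimality means that $C(\eta)$ is positive definite. For a positive density $q$ the Stein operator is $\mathcal T_qv=\operatorname{div}v+\langle\operatorname{grad}\log q,v\rangle_g$. "Admissible" means belonging to a chosen linear class of vector fields on which $\mathcal T_q$ and $v\mapsto-\operatorname{div}(qv)$ are defined (for example all smooth vector fields, or a reproducing kernel Hilbert space of $C^1$ vector fields). *)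

theory Defs
  imports "HOL-Analysis.Analysis"
begin

section \<open>Smooth maps between Euclidean spaces\<close>

text \<open>For open \<open>S\<close>, \<open>Ck_on k S f\<close> says that \<open>f\<close> is of class \<open>C^k\<close> on \<open>S\<close>: the iterated
  directional derivatives up to order \<open>k\<close> exist as Frechet derivatives and are continuous.\<close>

fun Ck_on :: "nat \<Rightarrow> 'a::real_normed_vector set \<Rightarrow> ('a \<Rightarrow> 'b::real_normed_vector) \<Rightarrow> bool" where
  "Ck_on 0 S f \<longleftrightarrow> continuous_on S f"
| "Ck_on (Suc k) S f \<longleftrightarrow>
     (\<forall>x\<in>S. f differentiable (at x)) \<and> (\<forall>w. Ck_on k S (\<lambda>x. frechet_derivative f (at x) w))"

definition smooth_on :: "'a::real_normed_vector set \<Rightarrow> ('a \<Rightarrow> 'b::real_normed_vector) \<Rightarrow> bool" where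
  "smooth_on S f \<longleftrightarrow> (\<forall>k. Ck_on k S f)"

definition positive_definite :: "real^'n^'n \<Rightarrow> bool" where
  "positive_definite A \<longleftrightarrow> transpose A = A \<and> (\<forall>x. x \<noteq> 0 \<longrightarrow> x \<bullet> (A *v x) > 0)"


section \<open>Closed oriented Riemannian manifolds\<close>

text \<open>The manifold is the whole type \<open>'m\<close>, its dimension is \<open>CARD('n)\<close>, and its smooth structure
  and orientation are given by an atlas of charts with orientation preserving smooth transition
  maps.  A chart is a pair of an open domain and a coordinate map; the values of the coordinate map
  outside the domain are irrelevant.\<close>

type_synonym ('m, 'n) chart = "'m set \<times> ('m \<Rightarrow> real^'n)"

abbreviation chart_dom :: "('m, 'n) chart \<Rightarrow> 'm set" where
  "chart_dom c \<equiv> fst c"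

abbreviation coords :: "('m, 'n) chart \<Rightarrow> 'm \<Rightarrow> real^'n" where
  "coords c \<equiv> snd c"

definition chart_img :: "('m, 'n) chart \<Rightarrow> (real^'n) set" where
  "chart_img c = coords c ` chart_dom c"

definition chart_inv :: "('m, 'n) chart \<Rightarrow> real^'n \<Rightarrow> 'm" where
  "chart_inv c = inv_into (chart_dom c) (coords c)"

definition is_chart :: "('m::topological_space, 'n::finite) chart \<Rightarrow> bool" where
  "is_chart c \<longleftrightarrow> open (chart_dom c) \<and> open (chart_img c) \<and>
     homeomorphism (chart_dom c) (chart_img c) (coords c) (chart_inv c)"

definition transition :: "('m, 'n) chart \<Rightarrow> ('m, 'n) chart \<Rightarrow> real^'n \<Rightarrow> real^'n" where
  "transition c c' = coords c' \<circ> chart_inv c"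

definition oriented_atlas :: "('m::topological_space, 'n::finite) chart set \<Rightarrow> bool" where
  "oriented_atlas atl \<longleftrightarrow>
     (\<forall>c\<in>atl. is_chart c) \<and> (\<Union>c\<in>atl. chart_dom c) = UNIV \<and>
     (\<forall>c\<in>atl. \<forall>c'\<in>atl.
        smooth_on (coords c ` (chart_dom c \<inter> chart_dom c')) (transition c c') \<and>
        (\<forall>y \<in> coords c ` (chart_dom c \<inter> chart_dom c'). det (jacobian (transition c c') (at y)) > 0))"

definition smooth_map ::
    "('m, 'n::finite) chart set \<Rightarrow> ('m \<Rightarrow> 'b::real_normed_vector) \<Rightarrow> bool" where
  "smooth_map atl f \<longleftrightarrow> (\<forall>c\<in>atl. smooth_on (chart_img c) (f \<circ> chart_inv c))"

text \<open>A tensor field is represented by its components in every chart of the atlas, related by the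
  usual transformation law; \<open>v c x $ i\<close> is the \<open>i\<close>-th component at \<open>x\<close> of the vector field \<open>v\<close>, and
  \<open>g c x $ i $ j\<close> the \<open>(i,j)\<close> component of the metric, with respect to the chart \<open>c\<close>.
  The values for \<open>x\<close> outside \<open>chart_dom c\<close> are irrelevant.\<close>

type_synonym ('m, 'n) vfield = "('m, 'n) chart \<Rightarrow> 'm \<Rightarrow> real^'n"

type_synonym ('m, 'n) metric_tensor = "('m, 'n) chart \<Rightarrow> 'm \<Rightarrow> real^'n^'n"

definition vector_field :: "('m, 'n::finite) chart set \<Rightarrow> ('m, 'n) vfield \<Rightarrow> bool" where
  "vector_field atl v \<longleftrightarrow>
     (\<forall>c\<in>atl. \<forall>c'\<in>atl. \<forall>x \<in> chart_dom c \<inter> chart_dom c'.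
        v c' x = jacobian (transition c c') (at (coords c x)) *v v c x)"

definition differentiable_vector_field ::
    "('m, 'n::finite) chart set \<Rightarrow> ('m, 'n) vfield \<Rightarrow> bool" where
  "differentiable_vector_field atl v \<longleftrightarrow> vector_field atl v \<and>
     (\<forall>c\<in>atl. (v c \<circ> chart_inv c) differentiable_on chart_img c)"

definition riemannian_metric ::
    "('m, 'n::finite) chart set \<Rightarrow> ('m, 'n) metric_tensor \<Rightarrow> bool" where
  "riemannian_metric atl g \<longleftrightarrow>
     (\<forall>c\<in>atl. \<forall>x\<in>chart_dom c. positive_definite (g c x)) \<and>
     (\<forall>c\<in>atl. smooth_on (chart_img c) (g c \<circ> chart_inv c)) \<and>
     (\<forall>c\<in>atl. \<forall>c'\<in>atl. \<forall>x \<in> chart_dom c \<inter> chart_dom c'.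
        let J = jacobian (transition c c') (at (coords c x))
        in g c x = transpose J ** g c' x ** J)"

text \<open>The Riemannian volume measure is the Borel measure given by \<open>sqrt (det g) dy\<close> in every
  chart; since countably many charts cover the manifold, this determines it.\<close>

definition riemannian_volume ::
    "('m::topological_space, 'n::finite) chart set \<Rightarrow> ('m, 'n) metric_tensor \<Rightarrow> 'm measure \<Rightarrow> bool"
  where
  "riemannian_volume atl g vol \<longleftrightarrow> sets vol = sets borel \<and>
     (\<forall>c\<in>atl. \<forall>B\<in>sets borel. B \<subseteq> chart_dom c \<longrightarrow>
        emeasure vol B =
          (\<integral>\<^sup>+ y \<in> coords c ` B. ennreal (sqrt (det (g c (chart_inv c y)))) \<partial>lborel))"

definition closed_oriented_riemannian_manifold ::
    "('m::{second_countable_topology, t2_space}, 'n::finite) chart set \<Rightarrow>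
     ('m, 'n) metric_tensor \<Rightarrow> 'm measure \<Rightarrow> bool"
  where
  "closed_oriented_riemannian_manifold atl g vol \<longleftrightarrow>
     compact (UNIV :: 'm set) \<and> connected (UNIV :: 'm set) \<and>
     oriented_atlas atl \<and> riemannian_metric atl g \<and> riemannian_volume atl g vol"


section \<open>Gradient, divergence and the Stein operator\<close>

definition chart_at :: "('m, 'n) chart set \<Rightarrow> 'm \<Rightarrow> ('m, 'n) chart" where
  "chart_at atl x = (SOME c. c \<in> atl \<and> x \<in> chart_dom c)"

definition partial_deriv ::
    "('m, 'n::finite) chart \<Rightarrow> 'n \<Rightarrow> ('m \<Rightarrow> real) \<Rightarrow> 'm \<Rightarrow> real" where
  "partial_deriv c i f x = frechet_derivative (f \<circ> chart_inv c) (at (coords c x)) (axis i 1)"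

definition gradient ::
    "('m, 'n::finite) metric_tensor \<Rightarrow> ('m \<Rightarrow> real) \<Rightarrow> ('m, 'n) vfield" where
  "gradient g f c x = matrix_inv (g c x) *v (\<chi> i. partial_deriv c i f x)"

text \<open>The local coordinate expressions below do not depend on the chart around \<open>x\<close>, so an arbitrary
  one is used.\<close>

definition riem_inner ::
    "('m, 'n::finite) chart set \<Rightarrow> ('m, 'n) metric_tensor \<Rightarrow>
     ('m, 'n) vfield \<Rightarrow> ('m, 'n) vfield \<Rightarrow> 'm \<Rightarrow> real"
  where
  "riem_inner atl g u v x = (let c = chart_at atl x in u c x \<bullet> (g c x *v v c x))"

definition divergence ::
    "('m, 'n::finite) chart set \<Rightarrow> ('m, 'n) metric_tensor \<Rightarrow> ('m, 'n) vfield \<Rightarrow> 'm \<Rightarrow> real"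
  where
  "divergence atl g v x =
     (let c = chart_at atl x in
        (\<Sum>i\<in>UNIV. partial_deriv c i (\<lambda>y. sqrt (det (g c y)) * v c y $ i) x) / sqrt (det (g c x)))"

definition stein_operator ::
    "('m, 'n::finite) chart set \<Rightarrow> ('m, 'n) metric_tensor \<Rightarrow>
     ('m \<Rightarrow> real) \<Rightarrow> ('m, 'n) vfield \<Rightarrow> 'm \<Rightarrow> real"
  where
  "stein_operator atl g q v x =
     divergence atl g v x + riem_inner atl g (gradient g (\<lambda>y. ln (q y))) v x"

definition scale_field :: "('m \<Rightarrow> real) \<Rightarrow> ('m, 'n::finite) vfield \<Rightarrow> ('m, 'n) vfield" where
  "scale_field q v = (\<lambda>c x. q x *\<^sub>R v c x)"

definition continuity_equation_at ::
    "('m, 'n::finite) chart set \<Rightarrow> ('m, 'n) metric_tensor \<Rightarrow> real set \<Rightarrow>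
     (real \<Rightarrow> 'm \<Rightarrow> real) \<Rightarrow> ('m, 'n) vfield \<Rightarrow> real \<Rightarrow> bool"
  where
  "continuity_equation_at atl g J q v t \<longleftrightarrow>
     (\<forall>x. ((\<lambda>s. q s x) has_real_derivative - divergence atl g (scale_field (q t) v) x) (at t within J))"

text \<open>A class of admissible vector fields is a linear space of vector fields on which the Stein
  operator and \<open>v \<mapsto> - div (q v)\<close> are defined pointwise, i.e. of differentiable ones.  All smooth
  vector fields and every linear space of \<open>C^1\<close> vector fields are instances.\<close>

definition admissible_class ::
    "('m, 'n::finite) chart set \<Rightarrow> ('m, 'n) vfield set \<Rightarrow> bool" where
  "admissible_class atl V \<longleftrightarrow>
     (\<forall>v\<in>V. differentiable_vector_field atl v) \<and>
     (\<lambda>c x. 0) \<in> V \<and>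
     (\<forall>u\<in>V. \<forall>v\<in>V. (\<lambda>c x. u c x + v c x) \<in> V) \<and>
     (\<forall>a. \<forall>v\<in>V. (\<lambda>c x. a *\<^sub>R v c x) \<in> V)"


section \<open>Exponential families\<close>

definition log_partition ::
    "'m measure \<Rightarrow> ('m \<Rightarrow> real) \<Rightarrow> ('m \<Rightarrow> real^'r) \<Rightarrow> real^'r \<Rightarrow> real" where
  "log_partition vol h T \<eta> = ln (LINT x|vol. h x * exp (\<eta> \<bullet> T x))"

definition expfam_density ::
    "'m measure \<Rightarrow> ('m \<Rightarrow> real) \<Rightarrow> ('m \<Rightarrow> real^'r) \<Rightarrow> real^'r \<Rightarrow> 'm \<Rightarrow> real" where
  "expfam_density vol h T \<eta> x = h x * exp (\<eta> \<bullet> T x - log_partition vol h T \<eta>)"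

definition expfam_expect ::
    "'m measure \<Rightarrow> ('m \<Rightarrow> real) \<Rightarrow> ('m \<Rightarrow> real^'r) \<Rightarrow> real^'r \<Rightarrow> ('m \<Rightarrow> real) \<Rightarrow> real" where
  "expfam_expect vol h T \<eta> f =
     (LINT x|density vol (\<lambda>x. ennreal (expfam_density vol h T \<eta> x)). f x)"

definition expect_coord ::
    "'m measure \<Rightarrow> ('m \<Rightarrow> real) \<Rightarrow> ('m \<Rightarrow> real^'r) \<Rightarrow> real^'r \<Rightarrow> real^'r" where
  "expect_coord vol h T \<eta> = (\<chi> j. expfam_expect vol h T \<eta> (\<lambda>x. T x $ j))"

definition expfam_cov ::
    "'m measure \<Rightarrow> ('m \<Rightarrow> real) \<Rightarrow> ('m \<Rightarrow> real^'r) \<Rightarrow> real^'r \<Rightarrow> real^'r^'r" where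
  "expfam_cov vol h T \<eta> = (\<chi> i j. expfam_expect vol h T \<eta>
     (\<lambda>x. (T x $ i - expect_coord vol h T \<eta> $ i) * (T x $ j - expect_coord vol h T \<eta> $ j)))"

text \<open>On a closed manifold the log-partition function is finite everywhere, so regularity amounts to
  openness of the natural parameter domain.\<close>

definition regular_minimal_expfam ::
    "('m, 'n::finite) chart set \<Rightarrow> 'm measure \<Rightarrow> ('m \<Rightarrow> real) \<Rightarrow> ('m \<Rightarrow> real^'r) \<Rightarrow>
     (real^'r) set \<Rightarrow> bool"
  where
  "regular_minimal_expfam atl vol h T \<Omega> \<longleftrightarrow>
     smooth_map atl T \<and> smooth_map atl h \<and> (\<forall>x. h x > 0) \<and> open \<Omega> \<and>
     (\<forall>\<eta>\<in>\<Omega>. positive_definite (expfam_cov vol h T \<eta>))"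

text \<open>The velocity field determined by the covector with components \<open>\<beta>\<close> with respect to the
  expectation coordinate covectors \<open>dm\<^sub>j\<close>, given Stein solutions \<open>\<psi> j\<close>.\<close>

definition covector_velocity ::
    "('r::finite \<Rightarrow> ('m, 'n::finite) vfield) \<Rightarrow> real^'r \<Rightarrow> ('m, 'n) vfield" where
  "covector_velocity \<psi> \<beta> = (\<lambda>c x. - (\<Sum>j\<in>UNIV. (\<beta> $ j) *\<^sub>R \<psi> j c x))"

end

theory Submission
  imports Defs
begin

text \<open>The identity \<open>div (q v) = q * stein q v\<close> (\<open>divergence_scale_field\<close>) and linearity of the Stein
  operator (\<open>stein_operator_covector_velocity\<close>) show that the field \<open>- \<Sum>j. \<beta>\<^sub>j \<psi>\<^sub>j\<close> has
  \<open>- div (q v) = q * (- \<beta> \<bullet> (T - m))\<close>.  On the other hand the gradient of the log-partition function is the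
  mean \<open>m\<close>, so a curve of parameters with velocity \<open>d\<close> moves the density at the rate \<open>q * (d \<bullet> (T - m))\<close>.
  With \<open>d = - \<beta>\<close> the two rates coincide, which is one half of the equivalence.

  Conversely the continuity equation prescribes the derivative of the log-density at every point, and
  a difference of two of these values is \<open>\<eta> \<bullet> (T x - T y)\<close> up to a constant.  A positive definite
  covariance makes the differences \<open>T x - T y\<close> span the parameter space, so \<open>\<eta>\<close> is differentiable with
  derivative \<open>- \<beta>\<close> (\<open>density_evolution_iff\<close>).  Since the Jacobian of \<open>m\<close> is the covariance matrix \<open>C\<close>
  (\<open>has_derivative_expect_coord\<close>), the chain rule turns \<open>\<eta>' = - \<beta>\<close> into \<open>m' = - C \<beta>\<close>.

  The derivatives of the log-partition function and of the mean come from a uniform quadratic estimate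
  under the integral, for which the volume must be finite (\<open>riemannian_volume_finite\<close>) and \<open>h\<close> and \<open>T\<close>
  bounded; both follow from compactness.\<close>


section \<open>Smoothness and nonsingular matrices\<close>

lemma smooth_on_imp_differentiable:
  "smooth_on S f \<Longrightarrow> x \<in> S \<Longrightarrow> f differentiable (at x)"
  unfolding smooth_on_def by (metis Ck_on.simps(2))

lemma smooth_on_imp_continuous_on: "smooth_on S f \<Longrightarrow> continuous_on S f"
  unfolding smooth_on_def by (metis Ck_on.simps(1))

text \<open>Only the nonvanishing of the determinant is extracted: this is what makes the volume factor
  \<open>sqrt (det g)\<close> differentiable and invertible, and the metric matrix invertible.\<close>

lemma positive_definite_imp_det_nonzero:
  fixes A :: "real^'n^'n"
  assumes "positive_definite A"
  shows "det A \<noteq> 0"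
proof -
  have "x = 0" if "A *v x = 0" for x
    using assms that by (metis inner_zero_right less_irrefl positive_definite_def)
  then have "\<exists>B. B ** A = mat 1"
    by (simp add: matrix_left_invertible_ker)
  then show ?thesis
    by (simp add: invertible_left_inverse flip: invertible_det_nz)
qed

lemma differentiable_det:
  fixes A :: "'a::real_normed_vector \<Rightarrow> real^'n^'n"
  assumes "A differentiable (at x)"
  shows "(\<lambda>y. det (A y)) differentiable (at x)"
proof -
  have entry: "(\<lambda>y. A y $ i $ j) differentiable (at x)" for i j
    by (intro differentiable_compose[of "\<lambda>M. M $ i $ j" A] assms bounded_linear_imp_differentiable
        bounded_linear_compose[OF bounded_linear_vec_nth bounded_linear_vec_nth])
  have "(\<lambda>y. \<Prod>i\<in>(UNIV :: 'n set). A y $ i $ p i) differentiable (at x)" for p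
    by (rule differentiableI[OF has_derivative_prod]) (rule entry[unfolded frechet_derivative_works])
  then show ?thesis
    unfolding det_def by (intro differentiable_sum differentiable_mult differentiable_const) auto
qed


section \<open>Charts and functions on the manifold\<close>

lemma chart_inv_coords:
  "is_chart c \<Longrightarrow> x \<in> chart_dom c \<Longrightarrow> chart_inv c (coords c x) = x"
  unfolding is_chart_def by (meson homeomorphism_apply1)

lemma coords_in_chart_img: "x \<in> chart_dom c \<Longrightarrow> coords c x \<in> chart_img c"
  by (simp add: chart_img_def)

lemma oriented_atlas_chart:
  assumes "oriented_atlas atl" "c \<in> atl"
  shows "is_chart c" "open (chart_dom c)" "open (chart_img c)"
  using assms unfolding oriented_atlas_def is_chart_def by blast+

lemma oriented_atlas_cover:
  assumes "oriented_atlas atl" obtains c where "c \<in> atl" "x \<in> chart_dom c"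
  using assms unfolding oriented_atlas_def by (metis UN_E UNIV_I)

lemma chart_at_in_atlas:
  assumes "oriented_atlas atl"
  shows "chart_at atl x \<in> atl" "x \<in> chart_dom (chart_at atl x)"
proof -
  have "\<exists>c. c \<in> atl \<and> x \<in> chart_dom c"
    using oriented_atlas_cover[OF assms] by metis
  then have "chart_at atl x \<in> atl \<and> x \<in> chart_dom (chart_at atl x)"
    unfolding chart_at_def by (rule someI_ex)
  then show "chart_at atl x \<in> atl" "x \<in> chart_dom (chart_at atl x)"
    by auto
qed

lemma smooth_map_imp_continuous_on:
  assumes atl: "oriented_atlas atl" and f: "smooth_map atl f"
  shows "continuous_on UNIV f"
proof -
  have "continuous_on (chart_dom c) f" if c: "c \<in> atl" for c
  proof -
    have "homeomorphism (chart_dom c) (chart_img c) (coords c) (chart_inv c)"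
      using oriented_atlas_chart(1)[OF atl c] by (simp add: is_chart_def)
    then have "continuous_on (chart_dom c) (coords c)"
      by (rule homeomorphism_cont1)
    moreover have "continuous_on (coords c ` chart_dom c) (f \<circ> chart_inv c)"
      using f c by (metis chart_img_def smooth_map_def smooth_on_imp_continuous_on)
    ultimately have "continuous_on (chart_dom c) ((f \<circ> chart_inv c) \<circ> coords c)"
      by (rule continuous_on_compose)
    then show ?thesis
      by (rule continuous_on_eq)
        (simp add: chart_inv_coords[OF oriented_atlas_chart(1)[OF atl c]])
  qed
  then have "continuous_on (\<Union>c\<in>atl. chart_dom c) f"
    by (intro continuous_on_open_UN) (auto intro: oriented_atlas_chart[OF atl])
  then show ?thesis
    using atl by (simp add: oriented_atlas_def)
qed

lemma smooth_map_imp_differentiable: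
  assumes "smooth_map atl f" "c \<in> atl" "x \<in> chart_dom c"
  shows "(f \<circ> chart_inv c) differentiable (at (coords c x))"
  using assms by (auto simp: smooth_map_def intro: smooth_on_imp_differentiable coords_in_chart_img)


section \<open>The Stein operator as a weighted divergence\<close>

lemma partial_deriv_has_derivative:
  assumes "((f \<circ> chart_inv c) has_derivative f') (at (coords c x))"
  shows "partial_deriv c i f x = f' (axis i 1)"
  unfolding partial_deriv_def using frechet_derivative_at[OF assms] by simp

lemma partial_deriv_mult:
  assumes f: "(f \<circ> chart_inv c) differentiable (at (coords c x))"
    and k: "(k \<circ> chart_inv c) differentiable (at (coords c x))"
    and x: "chart_inv c (coords c x) = x"
  shows "partial_deriv c i (\<lambda>y. f y * k y) x = f x * partial_deriv c i k x + partial_deriv c i f x * k x"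
proof -
  have "(((\<lambda>y. f y * k y) \<circ> chart_inv c) has_derivative
      (\<lambda>w. f x * frechet_derivative (k \<circ> chart_inv c) (at (coords c x)) w
         + frechet_derivative (f \<circ> chart_inv c) (at (coords c x)) w * k x)) (at (coords c x))"
    using has_derivative_mult[OF f[unfolded frechet_derivative_works] k[unfolded frechet_derivative_works]]
    by (simp add: o_def x)
  from partial_deriv_has_derivative[OF this] show ?thesis
    by (simp add: partial_deriv_def)
qed

lemma partial_deriv_ln:
  assumes f: "(f \<circ> chart_inv c) differentiable (at (coords c x))"
    and x: "chart_inv c (coords c x) = x" and pos: "f x > 0"
  shows "partial_deriv c i (\<lambda>y. ln (f y)) x = partial_deriv c i f x / f x"
proof -
  have "(((\<lambda>y. ln (f y)) \<circ> chart_inv c) has_derivative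
      (\<lambda>w. frechet_derivative (f \<circ> chart_inv c) (at (coords c x)) w * inverse (f x))) (at (coords c x))"
    using has_derivative_ln[of "f \<circ> chart_inv c" "coords c x", OF _ f[unfolded frechet_derivative_works]] pos
    by (simp add: o_def x)
  from partial_deriv_has_derivative[OF this] show ?thesis
    by (simp add: partial_deriv_def divide_inverse)
qed

lemma partial_deriv_sum:
  assumes "\<And>j. j \<in> I \<Longrightarrow> (f j \<circ> chart_inv c) differentiable (at (coords c x))"
  shows "partial_deriv c i (\<lambda>y. \<Sum>j\<in>I. a j * f j y) x = (\<Sum>j\<in>I. a j * partial_deriv c i (f j) x)"
proof -
  have "(((\<lambda>y. \<Sum>j\<in>I. a j * f j y) \<circ> chart_inv c) has_derivative
      (\<lambda>w. \<Sum>j\<in>I. a j * frechet_derivative (f j \<circ> chart_inv c) (at (coords c x)) w)) (at (coords c x))"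
    unfolding o_def
    by (intro has_derivative_sum has_derivative_mult_right)
       (use assms in \<open>simp add: frechet_derivative_works o_def\<close>)
  from partial_deriv_has_derivative[OF this] show ?thesis
    by (simp add: partial_deriv_def)
qed

lemma volume_factor_differentiable:
  assumes "riemannian_metric atl g" "c \<in> atl" "is_chart c" "x \<in> chart_dom c"
  shows "((\<lambda>y. sqrt (det (g c y))) \<circ> chart_inv c) differentiable (at (coords c x))"
    and "sqrt (det (g c x)) \<noteq> 0"
proof -
  have nz: "det (g c x) \<noteq> 0"
    using assms positive_definite_imp_det_nonzero unfolding riemannian_metric_def by blast
  then show "sqrt (det (g c x)) \<noteq> 0"
    by simp
  have "(g c \<circ> chart_inv c) differentiable (at (coords c x))"
    using assms unfolding riemannian_metric_def
    by (blast intro: smooth_on_imp_differentiable coords_in_chart_img)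
  from differentiable_det[OF this] obtain D where
    D: "((\<lambda>y. det (g c (chart_inv c y))) has_derivative D) (at (coords c x))"
    by (auto simp: differentiable_def)
  \<comment> \<open>\<open>sqrt\<close> is extended to the negative reals as an odd function, so it is differentiable at
    every nonzero point whatever the sign of the determinant.\<close>
  have "\<exists>d. (sqrt has_field_derivative d) (at (det (g c x)))"
    by (rule exI, rule DERIV_real_sqrt_generic[OF nz, where
          D = "(if det (g c x) > 0 then 1 else - 1) * inverse (sqrt (det (g c x))) / 2"]) auto
  then have "sqrt differentiable (at (det (g c x)))"
    using real_differentiable_def by blast
  then obtain d where "(sqrt has_derivative d) (at (det (g c x)))"
    by (auto simp: differentiable_def)
  then show "((\<lambda>y. sqrt (det (g c y))) \<circ> chart_inv c) differentiable (at (coords c x))"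
    using has_derivative_compose[OF D, of sqrt d] assms
    by (auto simp: differentiable_def o_def chart_inv_coords)
qed

lemma vector_field_component_differentiable:
  assumes v: "differentiable_vector_field atl v" and atl: "oriented_atlas atl"
    and c: "c \<in> atl" "x \<in> chart_dom c"
  shows "((\<lambda>y. v c y $ i) \<circ> chart_inv c) differentiable (at (coords c x))"
proof -
  have "(v c \<circ> chart_inv c) differentiable (at (coords c x))"
  proof -
    have "(v c \<circ> chart_inv c) differentiable_on chart_img c"
      using v c unfolding differentiable_vector_field_def by blast
    then show ?thesis
      using differentiable_on_eq_differentiable_at[OF oriented_atlas_chart(3)[OF atl c(1)]]
        coords_in_chart_img[OF c(2)] by blast
  qed
  from differentiable_compose[OF bounded_linear_imp_differentiable[OF bounded_linear_vec_nth[of i]] this]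
  show ?thesis
    unfolding o_def .
qed

text \<open>By symmetry of the metric matrix \<open>G\<close>, lowering the index of the gradient cancels the inverse
  metric in it: \<open>(G\<inverse> p) \<bullet> (G v) = p \<bullet> v\<close> for the vector \<open>p\<close> of partial derivatives.\<close>

lemma riem_inner_gradient:
  assumes atl: "oriented_atlas atl" and g: "riemannian_metric atl g"
  shows "riem_inner atl g (gradient g f) v x =
    (\<Sum>i\<in>UNIV. partial_deriv (chart_at atl x) i f x * v (chart_at atl x) x $ i)"
proof -
  let ?c = "chart_at atl x"
  let ?G = "g ?c x" and ?p = "\<chi> i. partial_deriv ?c i f x"
  have "positive_definite ?G"
    using g chart_at_in_atlas[OF atl, of x] unfolding riemannian_metric_def by blast
  then have sym: "transpose ?G = ?G" and invertible: "invertible ?G"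
    using positive_definite_imp_det_nonzero[of ?G]
    unfolding positive_definite_def invertible_det_nz by blast+
  from invertible have inv: "?G ** matrix_inv ?G = mat 1"
    unfolding matrix_inv_def invertible_def by (rule someI2_ex) (rule conjunct1)
  have "(matrix_inv ?G *v ?p) \<bullet> (?G *v v ?c x) = (?G *v (matrix_inv ?G *v ?p)) \<bullet> v ?c x"
    by (metis dot_lmul_matrix sym transpose_matrix_vector)
  also have "\<dots> = ?p \<bullet> v ?c x"
    by (simp add: matrix_vector_mul_assoc inv)
  finally show ?thesis
    by (simp add: riem_inner_def gradient_def Let_def inner_vec_def)
qed

text \<open>The product rule splits \<open>div (q v)\<close> into \<open>q div v\<close> and the derivative of \<open>q\<close> along \<open>v\<close>; the
  latter is \<open>q\<close> times the derivative of \<open>ln q\<close> along \<open>v\<close>, that is \<open>q \<langle>grad ln q, v\<rangle>\<close>.  This turns the right-hand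
  side of the continuity equation into a Stein operator.\<close>

lemma divergence_scale_field:
  assumes atl: "oriented_atlas atl" and g: "riemannian_metric atl g"
    and v: "differentiable_vector_field atl v"
    and q: "\<And>c. c \<in> atl \<Longrightarrow> x \<in> chart_dom c \<Longrightarrow> (q \<circ> chart_inv c) differentiable (at (coords c x))"
    and pos: "q x > 0"
  shows "divergence atl g (scale_field q v) x = q x * stein_operator atl g q v x"
proof -
  define c where "c = chart_at atl x"
  have c: "c \<in> atl" "x \<in> chart_dom c"
    using chart_at_in_atlas[OF atl] by (simp_all add: c_def)
  have chart: "is_chart c"
    using oriented_atlas_chart(1)[OF atl c(1)] .
  note x = chart_inv_coords[OF chart c(2)]
  define s where "s = (\<lambda>y. sqrt (det (g c y)))"
  have s: "(s \<circ> chart_inv c) differentiable (at (coords c x))" "s x \<noteq> 0"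
    using volume_factor_differentiable[OF g c(1) chart c(2)] by (simp_all add: s_def)
  note qd = q[OF c]
  have sv: "((\<lambda>y. s y * v c y $ i) \<circ> chart_inv c) differentiable (at (coords c x))" for i
    using differentiable_mult[OF s(1) vector_field_component_differentiable[OF v atl c, of i]]
    by (simp add: o_def)
  have div: "divergence atl g u x = (\<Sum>i\<in>UNIV. partial_deriv c i (\<lambda>y. s y * u c y $ i) x) / s x" for u
    by (simp add: divergence_def Let_def s_def c_def)
  have "partial_deriv c i (\<lambda>y. s y * scale_field q v c y $ i) x =
      q x * partial_deriv c i (\<lambda>y. s y * v c y $ i) x + s x * (partial_deriv c i q x * v c x $ i)" for i
    using partial_deriv_mult[OF qd sv[of i] x, of i]
    by (simp add: scale_field_def algebra_simps)
  then have "divergence atl g (scale_field q v) x =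
      (\<Sum>i\<in>UNIV. q x * partial_deriv c i (\<lambda>y. s y * v c y $ i) x + s x * (partial_deriv c i q x * v c x $ i)) / s x"
    by (simp add: div)
  also have "\<dots> = q x * divergence atl g v x + (\<Sum>i\<in>UNIV. partial_deriv c i q x * v c x $ i)"
    using s(2) by (simp add: div sum.distrib add_divide_distrib flip: sum_distrib_left)
  also have "(\<Sum>i\<in>UNIV. partial_deriv c i q x * v c x $ i) =
      q x * riem_inner atl g (gradient g (\<lambda>y. ln (q y))) v x"
    using pos by (simp add: riem_inner_gradient[OF atl g] partial_deriv_ln[OF qd x pos] sum_distrib_left
        flip: c_def)
  finally show ?thesis
    by (simp add: stein_operator_def algebra_simps)
qed

text \<open>The Stein operator is linear, so a prescribed combination of the Stein equations is solved by
  the same combination of their solutions.\<close>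

lemma stein_operator_covector_velocity:
  assumes atl: "oriented_atlas atl" and g: "riemannian_metric atl g"
    and \<psi>: "\<And>j. differentiable_vector_field atl (\<psi> j)"
  shows "stein_operator atl g q (covector_velocity \<psi> \<beta>) x =
    - (\<Sum>j\<in>UNIV. \<beta> $ j * stein_operator atl g q (\<psi> j) x)"
proof -
  define c where "c = chart_at atl x"
  have c: "c \<in> atl" "x \<in> chart_dom c"
    using chart_at_in_atlas[OF atl] by (simp_all add: c_def)
  have chart: "is_chart c"
    using oriented_atlas_chart(1)[OF atl c(1)] .
  define s where "s = (\<lambda>y. sqrt (det (g c y)))"
  have s: "(s \<circ> chart_inv c) differentiable (at (coords c x))"
    using volume_factor_differentiable[OF g c(1) chart c(2)] by (simp_all add: s_def)
  have s\<psi>: "((\<lambda>y. s y * \<psi> j c y $ i) \<circ> chart_inv c) differentiable (at (coords c x))" for i j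
    using differentiable_mult[OF s vector_field_component_differentiable[OF \<psi> atl c, of j i]]
    by (simp add: o_def)
  have div: "divergence atl g u x = (\<Sum>i\<in>UNIV. partial_deriv c i (\<lambda>y. s y * u c y $ i) x) / s x" for u
    by (simp add: divergence_def Let_def s_def c_def)
  let ?v = "covector_velocity \<psi> \<beta>"
  have "(\<lambda>y. s y * ?v c y $ i) = (\<lambda>y. \<Sum>j\<in>UNIV. - \<beta> $ j * (s y * \<psi> j c y $ i))" for i
    by (auto simp: covector_velocity_def sum_distrib_left sum_negf intro!: ext sum.cong)
  then have "partial_deriv c i (\<lambda>y. s y * ?v c y $ i) x =
      (\<Sum>j\<in>UNIV. - \<beta> $ j * partial_deriv c i (\<lambda>y. s y * \<psi> j c y $ i) x)" for i
    using partial_deriv_sum[of UNIV "\<lambda>j y. s y * \<psi> j c y $ i" c x i "\<lambda>j. - \<beta> $ j"] s\<psi> by simp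
  then have "divergence atl g ?v x =
      (\<Sum>i\<in>UNIV. \<Sum>j\<in>UNIV. - \<beta> $ j * partial_deriv c i (\<lambda>y. s y * \<psi> j c y $ i) x) / s x"
    by (simp add: div)
  also have "\<dots> = - (\<Sum>j\<in>UNIV. \<beta> $ j * divergence atl g (\<psi> j) x)"
    by (subst sum.swap) (simp add: div sum_negf sum_divide_distrib sum_distrib_left)
  finally have div_v: "divergence atl g ?v x = - (\<Sum>j\<in>UNIV. \<beta> $ j * divergence atl g (\<psi> j) x)" .
  have "riem_inner atl g u ?v x = - (\<Sum>j\<in>UNIV. \<beta> $ j * riem_inner atl g u (\<psi> j) x)" for u
    by (simp add: riem_inner_def Let_def covector_velocity_def linear_neg[OF matrix_vector_mul_linear]
        linear_sum[OF matrix_vector_mul_linear] linear_cmul[OF matrix_vector_mul_linear] inner_sum_right)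
  with div_v show ?thesis
    by (simp add: stein_operator_def distrib_left sum.distrib)
qed

lemma admissible_class_covector_velocity:
  assumes V: "admissible_class atl V" and \<psi>: "\<And>j. \<psi> j \<in> V"
  shows "covector_velocity \<psi> \<beta> \<in> V"
proof -
  have zero: "(\<lambda>c x. 0) \<in> V"
    and add: "u \<in> V \<Longrightarrow> v \<in> V \<Longrightarrow> (\<lambda>c x. u c x + v c x) \<in> V"
    and scale: "v \<in> V \<Longrightarrow> (\<lambda>c x. a *\<^sub>R v c x) \<in> V" for u v a
    using V by (simp_all add: admissible_class_def)
  have "(\<lambda>c x. \<Sum>j\<in>I. - \<beta> $ j *\<^sub>R \<psi> j c x) \<in> V" if "finite I" for I
    using that
  proof induction
    case empty
    then show ?case by (simp add: zero)
  next
    case (insert j I)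
    show ?case
      using add[OF scale[OF \<psi>, of "- \<beta> $ j" j] insert.IH] insert.hyps by simp
  qed
  from this[OF finite[of UNIV]] show ?thesis
    by (simp add: covector_velocity_def sum_negf)
qed


section \<open>Finiteness of the volume\<close>

text \<open>Every point has a neighbourhood corresponding to a small ball in a chart.  Its closed ball is
  compact, so the volume factor is bounded on it and the neighbourhood has finite volume; finitely many
  such neighbourhoods cover the compact manifold.\<close>

lemma riemannian_volume_finite:
  assumes M: "closed_oriented_riemannian_manifold atl g vol"
  shows "finite_measure vol"
proof -
  have cpt: "compact (UNIV :: 'a set)" and atl: "oriented_atlas atl" and g: "riemannian_metric atl g"
    and sets: "sets vol = sets borel"
    and vol: "\<And>c B. c \<in> atl \<Longrightarrow> B \<in> sets borel \<Longrightarrow> B \<subseteq> chart_dom c \<Longrightarrow> emeasure vol B =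
          (\<integral>\<^sup>+ y \<in> coords c ` B. ennreal (sqrt (det (g c (chart_inv c y)))) \<partial>lborel)"
    using M unfolding closed_oriented_riemannian_manifold_def riemannian_volume_def by blast+
  have "\<exists>B. open B \<and> x \<in> B \<and> emeasure vol B < \<infinity>" for x
  proof -
    obtain c where c: "c \<in> atl" "x \<in> chart_dom c"
      using oriented_atlas_cover[OF atl] .
    have hom: "homeomorphism (chart_dom c) (chart_img c) (coords c) (chart_inv c)"
      using oriented_atlas_chart(1)[OF atl c(1)] by (simp add: is_chart_def)
    obtain e where e: "e > 0" "cball (coords c x) e \<subseteq> chart_img c"
      using oriented_atlas_chart(3)[OF atl c(1)] coords_in_chart_img[OF c(2)]
      by (meson open_contains_cball)
    let ?s = "\<lambda>y. sqrt (det (g c (chart_inv c y)))"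
    have "(\<lambda>y. det (g c (chart_inv c y))) differentiable (at y)" if "y \<in> chart_img c" for y
    proof -
      have "(g c \<circ> chart_inv c) differentiable (at y)"
        using g c that unfolding riemannian_metric_def by (blast intro: smooth_on_imp_differentiable)
      from differentiable_det[OF this] show ?thesis by simp
    qed
    then have "continuous_on (cball (coords c x) e) ?s"
      using e(2) by (intro continuous_on_real_sqrt differentiable_imp_continuous_on)
        (auto simp: differentiable_on_def intro: differentiable_at_withinI)
    then have "bounded (?s ` cball (coords c x) e)"
      by (intro compact_imp_bounded compact_continuous_image compact_cball)
    then obtain K where K: "\<And>y. y \<in> cball (coords c x) e \<Longrightarrow> \<bar>?s y\<bar> \<le> K"
      unfolding bounded_iff by (metis imageI real_norm_def)
    define B where "B = chart_inv c ` ball (coords c x) e"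
    have sub: "ball (coords c x) e \<subseteq> chart_img c"
      using e(2) ball_subset_cball by blast
    have img: "coords c ` B = ball (coords c x) e"
    proof -
      have "coords c (chart_inv c y) = y" if "y \<in> ball (coords c x) e" for y
        using that sub hom by (meson homeomorphism_apply2 subsetD)
      then show ?thesis
        unfolding B_def image_image by simp
    qed
    have "B \<subseteq> chart_dom c"
      using sub hom unfolding B_def homeomorphism_def by blast
    then have B_eq: "B = chart_dom c \<inter> coords c -` ball (coords c x) e"
    proof (intro equalityI subsetI IntI vimageI2)
      fix y assume "y \<in> B"
      then show "y \<in> chart_dom c" "coords c y \<in> ball (coords c x) e"
        using \<open>B \<subseteq> chart_dom c\<close> img by blast+
    next
      fix y assume "y \<in> chart_dom c \<inter> coords c -` ball (coords c x) e"
      then have "y \<in> chart_dom c" "coords c y \<in> ball (coords c x) e"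
        by auto
      then show "y \<in> B"
        unfolding B_def using homeomorphism_apply1[OF hom] by (metis imageI)
    qed
    have "open B"
      unfolding B_eq using homeomorphism_cont1[OF hom] oriented_atlas_chart(2)[OF atl c(1)]
      by (intro continuous_open_preimage) auto
    moreover have "x \<in> B"
      using c e(1) by (simp add: B_eq)
    moreover have "emeasure vol B < \<infinity>"
    proof -
      have "emeasure vol B = (\<integral>\<^sup>+ y \<in> ball (coords c x) e. ennreal (?s y) \<partial>lborel)"
        using vol[OF c(1) _ \<open>B \<subseteq> chart_dom c\<close>] \<open>open B\<close> img by simp
      also have "\<dots> \<le> (\<integral>\<^sup>+ y \<in> ball (coords c x) e. ennreal K \<partial>lborel)"
        using K by (intro nn_integral_mono) (force simp: indicator_def intro: ennreal_leI abs_le_D1)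
      also have "\<dots> = ennreal K * emeasure lborel (ball (coords c x) e)"
        by (simp add: nn_integral_cmult_indicator)
      also have "\<dots> < \<infinity>"
        using emeasure_lborel_ball_finite[of "coords c x" e] by (simp add: ennreal_mult_less_top)
      finally show ?thesis .
    qed
    ultimately show ?thesis by blast
  qed
  then obtain B where B: "\<And>x. open (B x)" "\<And>x. x \<in> B x" "\<And>x. emeasure vol (B x) < \<infinity>"
    by metis
  obtain D where D: "finite D" "UNIV \<subseteq> (\<Union>x\<in>D. B x)"
  proof (rule compactE_image[OF cpt, of UNIV B])
    show "UNIV \<subseteq> (\<Union>x. B x)"
      using B(2) by blast
  qed (use B(1) in auto)
  have "emeasure vol (space vol) \<le> emeasure vol (\<Union>x\<in>D. B x)"
    using D B(1) sets by (intro emeasure_mono) auto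
  also have "\<dots> \<le> (\<Sum>x\<in>D. emeasure vol (B x))"
    using D B(1) sets by (intro emeasure_subadditive_finite) auto
  also have "\<dots> < \<infinity>"
    using D(1) B(3) by (simp add: ennreal_sum_less_top)
  finally show ?thesis
    by (intro finite_measureI) auto
qed


section \<open>Exponential families with bounded statistics\<close>

lemma exp_remainder_le:
  fixes u :: real
  shows "\<bar>exp u - 1 - u\<bar> \<le> exp \<bar>u\<bar> * u\<^sup>2"
proof -
  obtain s where s: "\<bar>s\<bar> \<le> \<bar>u\<bar>" "exp u = (\<Sum>m<2. u ^ m / fact m) + (exp s / fact 2) * u ^ 2"
    using Maclaurin_exp_le[of u 2] by blast
  then have "exp u - 1 - u = exp s / 2 * u\<^sup>2"
    by (simp add: numeral_2_eq_2)
  then have "\<bar>exp u - 1 - u\<bar> = exp s / 2 * u\<^sup>2"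
    by (simp only: abs_mult abs_power2 abs_divide abs_exp_cancel abs_numeral)
  moreover have "exp s / 2 \<le> exp \<bar>u\<bar>"
  proof -
    have "exp s \<le> exp \<bar>u\<bar>"
      using s(1) by simp
    then show ?thesis
      using exp_gt_zero[of s] by linarith
  qed
  ultimately show ?thesis
    by (metis mult_right_mono zero_le_power2)
qed

text \<open>On a closed manifold the base measure is finite and the reference density and the statistic are
  bounded.  These measure-theoretic properties alone give the calculus of the family.  One bound \<open>b\<close>
  serves both functions, and a null base measure is excluded so that the family can be normalised.\<close>

locale bounded_expfam = finite_measure M for M :: "'a measure" +
  fixes h :: "'a \<Rightarrow> real" and T :: "'a \<Rightarrow> real^'r::finite" and b :: real
  assumes h_measurable [measurable]: "h \<in> borel_measurable M"
    and T_measurable [measurable]: "T \<in> borel_measurable M"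
    and h_pos: "h x > 0" and h_le: "h x \<le> b" and T_le: "norm (T x) \<le> b"
    and nonnull: "emeasure M (space M) \<noteq> 0"
begin

definition weight :: "real^'r \<Rightarrow> 'a \<Rightarrow> real" where
  "weight \<theta> x = h x * exp (\<theta> \<bullet> T x)"

definition normalizer :: "real^'r \<Rightarrow> real" where
  "normalizer \<theta> = (LINT x|M. weight \<theta> x)"

text \<open>A class of functions that is closed under products and whose expectations exist under every
  member of the family, so that no integrability conditions have to be carried along.\<close>

definition observables :: "('a \<Rightarrow> real) set" where
  "observables = {f \<in> borel_measurable M. \<exists>K. \<forall>x. \<bar>f x\<bar> \<le> K}"

abbreviation "expect \<equiv> expfam_expect M h T"

abbreviation "mean \<equiv> expect_coord M h T"

lemma b_nonneg: "b \<ge> 0"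
  using h_pos h_le by (meson less_le_trans less_imp_le)

lemma weight_pos: "weight \<theta> x > 0"
  by (simp add: weight_def h_pos)

lemma weight_measurable [measurable]: "weight \<theta> \<in> borel_measurable M"
  unfolding weight_def by measurable

lemma inner_T_le: "\<bar>\<theta> \<bullet> T x\<bar> \<le> norm \<theta> * b"
  by (meson Cauchy_Schwarz_ineq2 T_le mult_left_mono norm_ge_zero order_trans)

lemma weight_le: "weight \<theta> x \<le> b * exp (norm \<theta> * b)"
proof -
  have "exp (\<theta> \<bullet> T x) \<le> exp (norm \<theta> * b)"
    using inner_T_le[of \<theta> x] by simp
  then show ?thesis
    unfolding weight_def using h_le h_pos b_nonneg
    by (intro mult_mono) (auto intro: less_imp_le)
qed

lemma observables_const [simp, intro]: "(\<lambda>x. a) \<in> observables"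
  by (auto simp: observables_def)

lemma observables_add [intro]:
  assumes "f \<in> observables" "k \<in> observables"
  shows "(\<lambda>x. f x + k x) \<in> observables"
proof -
  obtain A B where "\<And>x. \<bar>f x\<bar> \<le> A" "\<And>x. \<bar>k x\<bar> \<le> B"
    using assms by (auto simp: observables_def)
  then have "\<bar>f x + k x\<bar> \<le> A + B" for x
    by (meson abs_triangle_ineq add_mono order_trans)
  then show ?thesis
    using assms by (auto simp: observables_def)
qed

lemma observables_mult [intro]:
  assumes "f \<in> observables" "k \<in> observables"
  shows "(\<lambda>x. f x * k x) \<in> observables"
proof -
  obtain A B where AB: "\<And>x. \<bar>f x\<bar> \<le> A" "\<And>x. \<bar>k x\<bar> \<le> B"
    using assms by (auto simp: observables_def)
  have "\<bar>f x * k x\<bar> \<le> A * B" for x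
    unfolding abs_mult using AB[of x] by (intro mult_mono) auto
  then show ?thesis
    using assms by (auto simp: observables_def)
qed

lemma observables_diff [intro]:
  "f \<in> observables \<Longrightarrow> k \<in> observables \<Longrightarrow> (\<lambda>x. f x - k x) \<in> observables"
  using observables_add[OF _ observables_mult[OF observables_const[of "-1"]], of f k] by simp

lemma observables_inner_T [intro]: "(\<lambda>x. \<theta> \<bullet> T x) \<in> observables"
  using inner_T_le[of \<theta>] by (auto simp: observables_def)

lemma observables_T [intro]: "(\<lambda>x. T x $ j) \<in> observables"
  using observables_inner_T[of "axis j 1"] by (simp add: inner_axis')

lemma observables_centred [intro]: "(\<lambda>x. \<theta> \<bullet> (T x - c)) \<in> observables"
  unfolding inner_diff_right by auto

lemmas observables_intros = observables_const observables_T observables_inner_T observables_centred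
  observables_add observables_diff observables_mult

lemma integrable_weight:
  assumes "f \<in> observables"
  shows "integrable M (\<lambda>x. f x * weight \<theta> x)"
proof -
  have meas [measurable]: "f \<in> borel_measurable M"
    using assms by (simp add: observables_def)
  obtain K where K: "\<And>x. \<bar>f x\<bar> \<le> K"
    using assms by (auto simp: observables_def)
  show ?thesis
  proof (rule integrable_const_bound)
    show "AE x in M. norm (f x * weight \<theta> x) \<le> K * (b * exp (norm \<theta> * b))"
    proof (rule AE_I2)
      fix x
      show "norm (f x * weight \<theta> x) \<le> K * (b * exp (norm \<theta> * b))"
        using K[of x] weight_le[of \<theta> x] weight_pos[of \<theta> x] unfolding real_norm_def abs_mult
        by (intro mult_mono) auto
    qed
  qed measurable
qed

lemma normalizer_pos: "normalizer \<theta> > 0"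
proof -
  have int: "integrable M (weight \<theta>)"
    using integrable_weight[OF observables_const[of 1]] by simp
  have "normalizer \<theta> \<ge> 0"
    unfolding normalizer_def using weight_pos by (intro integral_nonneg_AE) (auto intro: less_imp_le)
  moreover have "normalizer \<theta> \<noteq> 0"
  proof
    assume "normalizer \<theta> = 0"
    then have "AE x in M. weight \<theta> x = 0"
      using integral_nonneg_eq_0_iff_AE[OF int] weight_pos by (auto simp: normalizer_def less_imp_le)
    then have "AE x in M. False"
      using weight_pos by (simp add: less_imp_neq[symmetric])
    then have "AE x in M. x \<notin> space M"
      by simp
    then have "space M \<in> null_sets M"
      by (simp add: AE_iff_null_sets)
    then show False
      using nonnull by (simp add: null_sets_def)
  qed
  ultimately show ?thesis by simp
qed

lemma log_partition_eq: "log_partition M h T \<theta> = ln (normalizer \<theta>)"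
  by (simp add: log_partition_def normalizer_def weight_def)

lemma density_eq: "expfam_density M h T \<theta> x = weight \<theta> x / normalizer \<theta>"
  by (simp add: expfam_density_def log_partition_eq weight_def exp_diff normalizer_pos)

lemma density_pos: "expfam_density M h T \<theta> x > 0"
  by (simp add: density_eq weight_pos normalizer_pos)

lemma expect_eq:
  assumes "f \<in> observables"
  shows "expect \<theta> f = (LINT x|M. f x * weight \<theta> x) / normalizer \<theta>"
proof -
  have [measurable]: "f \<in> borel_measurable M"
    using assms by (simp add: observables_def)
  have "expect \<theta> f = (LINT x|M. (weight \<theta> x / normalizer \<theta>) * f x)"
    unfolding expfam_expect_def density_eq using weight_pos normalizer_pos
    by (intro integral_real_density) (simp_all add: less_imp_le)
  also have "\<dots> = (LINT x|M. (f x * weight \<theta> x) / normalizer \<theta>)"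
    by (simp add: mult.commute)
  finally show ?thesis by simp
qed

lemma expect_const: "expect \<theta> (\<lambda>x. a) = a"
  using normalizer_pos[of \<theta>] by (simp add: expect_eq normalizer_def)

lemma expect_add:
  "f \<in> observables \<Longrightarrow> k \<in> observables \<Longrightarrow> expect \<theta> (\<lambda>x. f x + k x) = expect \<theta> f + expect \<theta> k"
  by (simp add: expect_eq observables_add distrib_right integrable_weight add_divide_distrib)

lemma expect_cmult: "f \<in> observables \<Longrightarrow> expect \<theta> (\<lambda>x. a * f x) = a * expect \<theta> f"
  by (simp add: expect_eq observables_mult mult.assoc)

lemma expect_diff:
  "f \<in> observables \<Longrightarrow> k \<in> observables \<Longrightarrow> expect \<theta> (\<lambda>x. f x - k x) = expect \<theta> f - expect \<theta> k"
  by (simp add: expect_eq observables_diff left_diff_distrib integrable_weight diff_divide_distrib)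

lemma expect_sum:
  assumes "finite I" "\<And>j. j \<in> I \<Longrightarrow> f j \<in> observables"
  shows "(\<lambda>x. \<Sum>j\<in>I. f j x) \<in> observables \<and> expect \<theta> (\<lambda>x. \<Sum>j\<in>I. f j x) = (\<Sum>j\<in>I. expect \<theta> (f j))"
  using assms by induction (auto simp: expect_const expect_add)

lemma expect_inner_T: "expect \<theta> (\<lambda>x. \<delta> \<bullet> T x) = \<delta> \<bullet> mean \<theta>"
proof -
  have "expect \<theta> (\<lambda>x. \<Sum>j\<in>UNIV. \<delta> $ j * T x $ j) = (\<Sum>j\<in>UNIV. expect \<theta> (\<lambda>x. \<delta> $ j * T x $ j))"
    by (intro expect_sum[THEN conjunct2] finite observables_intros)
  then show ?thesis
    by (simp add: inner_vec_def expect_cmult[OF observables_T] expect_coord_def)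
qed

lemma expect_centred: "expect \<theta> (\<lambda>x. \<delta> \<bullet> (T x - mean \<theta>)) = 0"
  by (simp add: inner_diff_right expect_diff[OF observables_inner_T observables_const]
      expect_inner_T expect_const)

text \<open>Differentiation under the integral sign.  The increment of the weight is
  \<open>weight \<theta> x * (exp (\<delta> \<bullet> T x) - 1)\<close>, and since \<open>T\<close> is bounded the second order remainder of the
  exponential is at most a constant times \<open>(norm \<delta>)\<^sup>2\<close>, uniformly in \<open>x\<close>.\<close>

lemma has_derivative_moment:
  assumes f: "f \<in> observables"
  shows "((\<lambda>\<theta>. LINT x|M. f x * weight \<theta> x) has_derivative
    (\<lambda>\<delta>. LINT x|M. (f x * (\<delta> \<bullet> T x)) * weight \<theta> x)) (at \<theta>)"
proof -
  let ?N = "\<lambda>\<theta>. LINT x|M. f x * weight \<theta> x"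
  let ?D = "\<lambda>\<delta>. LINT x|M. (f x * (\<delta> \<bullet> T x)) * weight \<theta> x"
  obtain K where K: "\<And>x. \<bar>f x\<bar> \<le> K"
    using f by (auto simp: observables_def)
  have int_D: "integrable M (\<lambda>x. (f x * (\<delta> \<bullet> T x)) * weight \<theta> x)" for \<delta>
    using f by (intro integrable_weight) auto
  have "linear ?D"
  proof (rule linearI)
    show "?D (\<delta> + \<epsilon>) = ?D \<delta> + ?D \<epsilon>" for \<delta> \<epsilon>
      unfolding Bochner_Integration.integral_add[OF int_D int_D, symmetric]
      by (simp add: inner_add_left algebra_simps)
    show "?D (a *\<^sub>R \<delta>) = a *\<^sub>R ?D \<delta>" for a \<delta>
      by (simp add: mult.assoc mult.left_commute[of _ a])
  qed
  then have lin: "bounded_linear ?D"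
    by (simp add: linear_conv_bounded_linear)
  define C where "C = K * (exp b * b\<^sup>2) * normalizer \<theta>"
  show ?thesis
  proof (rule has_derivativeI_sandwich[where e = 1 and H = "\<lambda>\<eta>. C * norm (\<eta> - \<theta>)"])
    fix \<eta> assume \<eta>: "\<eta> \<noteq> \<theta>" "dist \<eta> \<theta> < 1"
    define \<delta> where "\<delta> = \<eta> - \<theta>"
    have \<delta>: "norm \<delta> \<le> 1" "norm \<delta> > 0"
      using \<eta> by (auto simp: \<delta>_def dist_norm)
    have weight_\<eta>: "weight \<eta> x = weight \<theta> x * exp (\<delta> \<bullet> T x)" for x
      by (simp add: \<delta>_def weight_def inner_diff_left mult.assoc flip: exp_add)
    have "?N \<eta> - ?N \<theta> - ?D \<delta> = (LINT x|M. f x * weight \<eta> x - f x * weight \<theta> x - (f x * (\<delta> \<bullet> T x)) * weight \<theta> x)"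
      by (simp add: integrable_weight[OF f] int_D)
    also have "\<dots> = (LINT x|M. f x * weight \<theta> x * (exp (\<delta> \<bullet> T x) - 1 - \<delta> \<bullet> T x))"
      by (simp add: weight_\<eta> algebra_simps)
    also have "norm \<dots> \<le> (LINT x|M. K * (exp b * (b\<^sup>2 * (norm \<delta>)\<^sup>2)) * weight \<theta> x)"
    proof (rule order_trans[OF integral_norm_bound integral_mono])
      show "integrable M (\<lambda>x. norm (f x * weight \<theta> x * (exp (\<delta> \<bullet> T x) - 1 - \<delta> \<bullet> T x)))"
      proof -
        have "integrable M (\<lambda>x. f x * weight \<eta> x - f x * weight \<theta> x - (f x * (\<delta> \<bullet> T x)) * weight \<theta> x)"
          by (intro Bochner_Integration.integrable_diff integrable_weight[OF f] int_D)
        then have "integrable M (\<lambda>x. f x * weight \<theta> x * (exp (\<delta> \<bullet> T x) - 1 - \<delta> \<bullet> T x))"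
          by (simp add: weight_\<eta> algebra_simps)
        then show ?thesis
          by (rule integrable_norm)
      qed
      show "integrable M (\<lambda>x. K * (exp b * (b\<^sup>2 * (norm \<delta>)\<^sup>2)) * weight \<theta> x)"
        by (intro integrable_weight observables_const)
      fix x
      let ?u = "\<delta> \<bullet> T x"
      have u: "\<bar>?u\<bar> \<le> b * norm \<delta>"
        using inner_T_le[of \<delta> x] by (simp add: mult.commute)
      also have "\<dots> \<le> b"
        using mult_left_mono[OF \<delta>(1) b_nonneg] by simp
      finally have "exp \<bar>?u\<bar> \<le> exp b"
        by simp
      moreover have "?u\<^sup>2 \<le> b\<^sup>2 * (norm \<delta>)\<^sup>2"
        using power_mono[OF u, of 2] by (simp add: power_mult_distrib)
      ultimately have "exp \<bar>?u\<bar> * ?u\<^sup>2 \<le> exp b * (b\<^sup>2 * (norm \<delta>)\<^sup>2)"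
        by (intro mult_mono) auto
      then have "\<bar>exp ?u - 1 - ?u\<bar> \<le> exp b * (b\<^sup>2 * (norm \<delta>)\<^sup>2)"
        using exp_remainder_le order_trans by blast
      then have "\<bar>f x\<bar> * \<bar>exp ?u - 1 - ?u\<bar> \<le> K * (exp b * (b\<^sup>2 * (norm \<delta>)\<^sup>2))"
        using K[of x] by (intro mult_mono) auto
      then have "\<bar>f x\<bar> * \<bar>exp ?u - 1 - ?u\<bar> * weight \<theta> x \<le> K * (exp b * (b\<^sup>2 * (norm \<delta>)\<^sup>2)) * weight \<theta> x"
        using weight_pos[of \<theta> x] by (intro mult_right_mono) auto
      then show "norm (f x * weight \<theta> x * (exp ?u - 1 - ?u)) \<le> K * (exp b * (b\<^sup>2 * (norm \<delta>)\<^sup>2)) * weight \<theta> x"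
        using weight_pos[of \<theta> x] by (simp add: abs_mult mult_ac)
    qed
    also have "\<dots> = C * (norm \<delta>)\<^sup>2"
      by (simp add: C_def normalizer_def mult_ac)
    finally have "norm (?N \<eta> - ?N \<theta> - ?D \<delta>) / norm \<delta> \<le> C * norm \<delta>"
      using \<delta>(2) by (simp add: divide_le_eq power2_eq_square mult_ac)
    then show "norm (?N \<eta> - ?N \<theta> - ?D (\<eta> - \<theta>)) / norm (\<eta> - \<theta>) \<le> C * norm (\<eta> - \<theta>)"
      by (simp add: \<delta>_def)
  next
    have "((\<lambda>\<eta>. C * norm (\<eta> - \<theta>)) \<longlongrightarrow> C * norm (\<theta> - \<theta>)) (at \<theta>)"
      by (intro tendsto_intros)
    then show "((\<lambda>\<eta>. C * norm (\<eta> - \<theta>)) \<longlongrightarrow> 0) (at \<theta>)"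
      by simp
  qed (use lin in auto)
qed

lemma has_derivative_normalizer:
  "(normalizer has_derivative (\<lambda>\<delta>. (\<delta> \<bullet> mean \<theta>) * normalizer \<theta>)) (at \<theta>)"
proof -
  have "(normalizer has_derivative (\<lambda>\<delta>. LINT x|M. (\<delta> \<bullet> T x) * weight \<theta> x)) (at \<theta>)"
    using has_derivative_moment[OF observables_const[of 1], of \<theta>]
    by (simp add: normalizer_def[abs_def])
  moreover have "(LINT x|M. (\<delta> \<bullet> T x) * weight \<theta> x) = (\<delta> \<bullet> mean \<theta>) * normalizer \<theta>" for \<delta>
    using normalizer_pos[of \<theta>]
    by (simp add: expect_eq[OF observables_inner_T] flip: expect_inner_T)
  ultimately show ?thesis
    by simp
qed

lemma has_derivative_log_partition:
  "(log_partition M h T has_derivative (\<lambda>\<delta>. \<delta> \<bullet> mean \<theta>)) (at \<theta>)"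
proof -
  have "normalizer \<theta> \<noteq> 0"
    using normalizer_pos[of \<theta>] by simp
  then show ?thesis
    using has_derivative_ln[OF normalizer_pos has_derivative_normalizer, of \<theta>]
    by (simp add: log_partition_eq[abs_def] mult.assoc)
qed

text \<open>The quotient rule for moment over normalizer.  Differentiating an expectation along \<open>\<delta>\<close> yields
  its covariance with the statistic in direction \<open>\<delta>\<close>.\<close>

lemma has_derivative_expect:
  assumes f: "f \<in> observables"
  shows "((\<lambda>\<theta>. expect \<theta> f) has_derivative
    (\<lambda>\<delta>. expect \<theta> (\<lambda>x. f x * (\<delta> \<bullet> (T x - mean \<theta>))))) (at \<theta>)"
proof -
  have Z: "normalizer \<theta> \<noteq> 0"
    using normalizer_pos[of \<theta>] by simp
  have moment: "(LINT x|M. k x * weight \<theta> x) = expect \<theta> k * normalizer \<theta>" if "k \<in> observables" for k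
    using Z by (simp add: expect_eq that)
  have cov: "expect \<theta> (\<lambda>x. f x * (\<delta> \<bullet> (T x - mean \<theta>))) =
      expect \<theta> (\<lambda>x. f x * (\<delta> \<bullet> T x)) - (\<delta> \<bullet> mean \<theta>) * expect \<theta> f" for \<delta>
  proof -
    have "(\<lambda>x. f x * (\<delta> \<bullet> (T x - mean \<theta>))) = (\<lambda>x. f x * (\<delta> \<bullet> T x) - (\<delta> \<bullet> mean \<theta>) * f x)"
      by (auto simp: inner_diff_right algebra_simps)
    then show ?thesis
      using f by (simp only: expect_diff[OF observables_mult[OF f observables_inner_T]
            observables_mult[OF observables_const f]] expect_cmult[OF f])
  qed
  have "((\<lambda>\<theta>. (LINT x|M. f x * weight \<theta> x) / normalizer \<theta>) has_derivative
      (\<lambda>\<delta>. expect \<theta> (\<lambda>x. f x * (\<delta> \<bullet> (T x - mean \<theta>))))) (at \<theta>)"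
    by (rule has_derivative_eq_rhs[OF has_derivative_divide'[OF has_derivative_moment[OF f] has_derivative_normalizer Z]])
      (use Z in \<open>simp add: fun_eq_iff cov moment[OF f] moment[OF observables_mult[OF f observables_inner_T], unfolded mult.assoc]
          field_simps\<close>)
  then show ?thesis
    by (simp add: expect_eq[OF f])
qed

lemma cov_mult_component:
  "(expfam_cov M h T \<theta> *v v) $ i = expect \<theta> (\<lambda>x. (T x $ i - mean \<theta> $ i) * (v \<bullet> (T x - mean \<theta>)))"
proof -
  have "expect \<theta> (\<lambda>x. \<Sum>j\<in>UNIV. v $ j * ((T x $ i - mean \<theta> $ i) * (T x $ j - mean \<theta> $ j))) =
      (\<Sum>j\<in>UNIV. expect \<theta> (\<lambda>x. v $ j * ((T x $ i - mean \<theta> $ i) * (T x $ j - mean \<theta> $ j))))"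
    by (intro expect_sum[THEN conjunct2] finite observables_intros)
  also have "\<dots> = (\<Sum>j\<in>UNIV. v $ j * expect \<theta> (\<lambda>x. (T x $ i - mean \<theta> $ i) * (T x $ j - mean \<theta> $ j)))"
    by (intro sum.cong refl expect_cmult observables_intros)
  finally show ?thesis
    by (simp add: matrix_vector_mult_def expfam_cov_def inner_vec_def sum_distrib_left mult_ac)
qed

lemma cov_quadratic_form:
  "v \<bullet> (expfam_cov M h T \<theta> *v v) = expect \<theta> (\<lambda>x. (v \<bullet> (T x - mean \<theta>))\<^sup>2)"
proof -
  have "expect \<theta> (\<lambda>x. \<Sum>i\<in>UNIV. v $ i * ((T x $ i - mean \<theta> $ i) * (v \<bullet> (T x - mean \<theta>)))) =
      (\<Sum>i\<in>UNIV. expect \<theta> (\<lambda>x. v $ i * ((T x $ i - mean \<theta> $ i) * (v \<bullet> (T x - mean \<theta>)))))"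
    by (intro expect_sum[THEN conjunct2] finite observables_intros)
  also have "\<dots> = (\<Sum>i\<in>UNIV. v $ i * expect \<theta> (\<lambda>x. (T x $ i - mean \<theta> $ i) * (v \<bullet> (T x - mean \<theta>))))"
    by (intro sum.cong refl expect_cmult observables_intros)
  also have "\<dots> = v \<bullet> (expfam_cov M h T \<theta> *v v)"
    by (simp add: inner_vec_def[of v "_ *v _"] cov_mult_component)
  finally show ?thesis
    by (simp add: inner_vec_def power2_eq_square sum_distrib_right mult.assoc)
qed

text \<open>Differentiating the expectation of \<open>T\<^sub>i\<close> puts \<open>T\<^sub>i\<close> itself where the covariance has its centred
  version; the two agree because a centred statistic has expectation zero.\<close>

lemma has_derivative_expect_coord:
  "(mean has_derivative (\<lambda>\<delta>. expfam_cov M h T \<theta> *v \<delta>)) (at \<theta>)"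
proof -
  have "((\<lambda>\<theta>. mean \<theta> $ i) has_derivative (\<lambda>\<delta>. (expfam_cov M h T \<theta> *v \<delta>) $ i)) (at \<theta>)" for i
  proof -
    have "expect \<theta> (\<lambda>x. T x $ i * (\<delta> \<bullet> (T x - mean \<theta>))) = (expfam_cov M h T \<theta> *v \<delta>) $ i" for \<delta>
    proof -
      have "(expfam_cov M h T \<theta> *v \<delta>) $ i =
          expect \<theta> (\<lambda>x. T x $ i * (\<delta> \<bullet> (T x - mean \<theta>)) - mean \<theta> $ i * (\<delta> \<bullet> (T x - mean \<theta>)))"
        by (simp add: cov_mult_component left_diff_distrib)
      also have "\<dots> = expect \<theta> (\<lambda>x. T x $ i * (\<delta> \<bullet> (T x - mean \<theta>)))
          - mean \<theta> $ i * expect \<theta> (\<lambda>x. \<delta> \<bullet> (T x - mean \<theta>))"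
        by (simp only: expect_diff[OF observables_mult[OF observables_T observables_centred]
              observables_mult[OF observables_const observables_centred]]
            expect_cmult[OF observables_centred])
      finally show ?thesis
        by (simp add: expect_centred)
    qed
    then show ?thesis
      using has_derivative_expect[OF observables_T, of i \<theta>] by (simp add: expect_coord_def)
  qed
  then show ?thesis
    by (subst has_derivative_componentwise_within) (auto simp: Basis_vec_def inner_axis)
qed

text \<open>A vector \<open>a\<close> orthogonal to all differences makes \<open>a \<bullet> T\<close> constant, hence equal to its mean, so
  its variance \<open>a \<bullet> C a\<close> vanishes; positive definiteness then forces \<open>a = 0\<close>.\<close>

lemma minimal_imp_span_differences:
  assumes "positive_definite (expfam_cov M h T \<theta>)"
  shows "span (range (\<lambda>(x, y). T x - T y)) = UNIV"
proof (rule ccontr)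
  assume "span (range (\<lambda>(x, y). T x - T y)) \<noteq> UNIV"
  then obtain a where a: "a \<noteq> 0" "\<And>w. w \<in> span (range (\<lambda>(x, y). T x - T y)) \<Longrightarrow> a \<bullet> w = 0"
    using span_not_UNIV_orthogonal by blast
  have const: "a \<bullet> T x = a \<bullet> T y" for x y
  proof -
    have "T x - T y \<in> span (range (\<lambda>(x, y). T x - T y))"
      by (intro span_base image_eqI[of _ _ "(x, y)"]) auto
    from a(2)[OF this] show ?thesis
      by (simp add: inner_diff_right)
  qed
  have "a \<bullet> (T x - mean \<theta>) = 0" for x
  proof -
    have "a \<bullet> mean \<theta> = expect \<theta> (\<lambda>y. a \<bullet> T y)"
      by (simp add: expect_inner_T)
    also have "(\<lambda>y. a \<bullet> T y) = (\<lambda>y. a \<bullet> T x)"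
      using const by blast
    finally show ?thesis
      by (simp add: expect_const inner_diff_right)
  qed
  then have "a \<bullet> (expfam_cov M h T \<theta> *v a) = 0"
    by (simp add: cov_quadratic_form expect_const)
  then show False
    using assms a(1) unfolding positive_definite_def by force
qed

end


section \<open>Evolution of the density and of the parameter\<close>

lemma has_vector_derivative_if_spanning:
  fixes f :: "real \<Rightarrow> 'a::euclidean_space"
  assumes B: "span B = UNIV"
    and deriv: "\<And>w. w \<in> B \<Longrightarrow> ((\<lambda>s. f s \<bullet> w) has_real_derivative d \<bullet> w) (at t within J)"
  shows "(f has_vector_derivative d) (at t within J)"
proof -
  have "((\<lambda>s. f s \<bullet> w) has_real_derivative d \<bullet> w) (at t within J)" if "w \<in> span B" for w
    using that
  proof (induction rule: span_induct_alt)
    case base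
    then show ?case by simp
  next
    case (step c x y)
    then show ?case
      using DERIV_add[OF DERIV_cmult[OF deriv[OF step(1)], of c] step(2)]
      by (simp add: inner_add_right)
  qed
  then have "((\<lambda>s. f s \<bullet> w) has_real_derivative d \<bullet> w) (at t within J)" for w
    by (simp add: B)
  then show ?thesis
    unfolding has_vector_derivative_def
    by (subst has_derivative_componentwise_within)
      (simp add: has_field_derivative_def mult_commute_abs)
qed

context bounded_expfam
begin

lemma ln_density: "ln (expfam_density M h T \<theta> x) = ln (h x) + (\<theta> \<bullet> T x - log_partition M h T \<theta>)"
  using h_pos[of x] by (simp add: expfam_density_def ln_mult)

lemma density_has_derivative:
  assumes \<eta>: "(\<eta> has_vector_derivative d) (at t within J)"
  shows "((\<lambda>s. expfam_density M h T (\<eta> s) x) has_real_derivative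
    expfam_density M h T (\<eta> t) x * (d \<bullet> (T x - mean (\<eta> t)))) (at t within J)"
proof -
  have "((\<lambda>s. log_partition M h T (\<eta> s)) has_real_derivative d \<bullet> mean (\<eta> t)) (at t within J)"
    using has_derivative_compose[OF \<eta>[unfolded has_vector_derivative_def] has_derivative_log_partition]
    by (simp add: has_field_derivative_def mult_commute_abs)
  moreover have "((\<lambda>s. \<eta> s \<bullet> T x) has_real_derivative d \<bullet> T x) (at t within J)"
    using has_derivative_inner_left[OF \<eta>[unfolded has_vector_derivative_def], of "T x"]
    by (simp add: has_field_derivative_def mult_commute_abs)
  ultimately have "((\<lambda>s. \<eta> s \<bullet> T x - log_partition M h T (\<eta> s)) has_real_derivative
      d \<bullet> (T x - mean (\<eta> t))) (at t within J)"
    unfolding inner_diff_right by (intro DERIV_diff)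
  from DERIV_cmult[OF DERIV_chain2[OF DERIV_exp this], of "h x"] show ?thesis
    by (simp add: expfam_density_def mult.assoc)
qed

text \<open>A curve in the family determines its parameter infinitesimally.  The log-density at \<open>x\<close> is
  \<open>ln (h x) + \<eta> \<bullet> T x - A(\<eta>)\<close>, and subtracting the one at \<open>y\<close> cancels the log-partition function, leaving
  \<open>\<eta> \<bullet> (T x - T y)\<close> up to a constant.  So pointwise differentiability of the density gives the derivative
  of \<open>\<eta>\<close> tested against all differences of \<open>T\<close>, which span by minimality.  Differentiability of
  the curve of parameters is thus a conclusion.\<close>

lemma density_evolution_iff:
  assumes minimal: "positive_definite (expfam_cov M h T (\<eta> t))"
  shows "(\<forall>x. ((\<lambda>s. expfam_density M h T (\<eta> s) x) has_real_derivative
      expfam_density M h T (\<eta> t) x * (d \<bullet> (T x - mean (\<eta> t)))) (at t within J))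
    \<longleftrightarrow> (\<eta> has_vector_derivative d) (at t within J)"
proof
  assume flow: "\<forall>x. ((\<lambda>s. expfam_density M h T (\<eta> s) x) has_real_derivative
      expfam_density M h T (\<eta> t) x * (d \<bullet> (T x - mean (\<eta> t)))) (at t within J)"
  have log: "((\<lambda>s. ln (expfam_density M h T (\<eta> s) x)) has_real_derivative d \<bullet> (T x - mean (\<eta> t))) (at t within J)" for x
  proof -
    have "expfam_density M h T (\<eta> t) x \<noteq> 0"
      using density_pos[of "\<eta> t" x] by simp
    then show ?thesis
      using DERIV_chain2[OF DERIV_ln[OF density_pos] flow[rule_format, of x]]
      by (simp flip: mult.assoc)
  qed
  have "((\<lambda>s. \<eta> s \<bullet> (T x - T y)) has_real_derivative d \<bullet> (T x - T y)) (at t within J)" for x y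
  proof -
    have "((\<lambda>s. ln (expfam_density M h T (\<eta> s) x) - ln (expfam_density M h T (\<eta> s) y) - (ln (h x) - ln (h y)))
        has_real_derivative d \<bullet> (T x - mean (\<eta> t)) - d \<bullet> (T y - mean (\<eta> t)) - 0) (at t within J)"
      by (intro DERIV_diff log DERIV_const)
    then show ?thesis
      by (simp add: ln_density inner_diff_right)
  qed
  then show "(\<eta> has_vector_derivative d) (at t within J)"
    by (intro has_vector_derivative_if_spanning[OF minimal_imp_span_differences[OF minimal]]) auto
qed (blast intro: density_has_derivative)

lemma expect_coord_has_vector_derivative:
  assumes "(\<eta> has_vector_derivative d) (at t within J)"
  shows "((\<lambda>s. mean (\<eta> s)) has_vector_derivative expfam_cov M h T (\<eta> t) *v d) (at t within J)"
  using has_derivative_compose[OF assms[unfolded has_vector_derivative_def] has_derivative_expect_coord]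
  by (simp add: has_vector_derivative_def linear_cmul[OF matrix_vector_mul_linear])

end

text \<open>Under a null base measure every expectation is zero, so the covariance matrix vanishes.  Hence
  minimality already forces the total volume to be nonzero.\<close>

lemma positive_definite_cov_imp_nonnull:
  assumes [measurable]: "h \<in> borel_measurable M" "T \<in> borel_measurable M"
    and pd: "positive_definite (expfam_cov M h T \<theta>)"
  shows "emeasure M (space M) \<noteq> 0"
proof
  assume "emeasure M (space M) = 0"
  then have "AE x in M. False"
    by (intro AE_I[of _ _ "space M"]) auto
  moreover have "(\<lambda>x. ennreal (expfam_density M h T \<theta> x)) \<in> borel_measurable M"
    unfolding expfam_density_def by measurable
  ultimately have "AE x in density M (\<lambda>x. ennreal (expfam_density M h T \<theta> x)). f x = 0" for f :: "'a \<Rightarrow> real"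
    by (auto simp: AE_density elim: eventually_mono)
  then have "expfam_expect M h T \<theta> f = 0" for f
    unfolding expfam_expect_def by (rule integral_eq_zero_AE)
  then have "expfam_cov M h T \<theta> = 0"
    by (simp add: expfam_cov_def vec_eq_iff)
  then have "1 \<bullet> (expfam_cov M h T \<theta> *v 1) = 0"
    by simp
  moreover have "(1 :: real^'b) \<noteq> 0"
    by (simp add: vec_eq_iff)
  ultimately show False
    using pd unfolding positive_definite_def by (metis less_irrefl)
qed


section \<open>Stein solutions realise natural parameter descent\<close>

lemma regular_minimal_expfam_imp_bounded:
  assumes M: "closed_oriented_riemannian_manifold atl g vol"
    and fam: "regular_minimal_expfam atl vol h T \<Omega>" and \<theta>: "\<theta> \<in> \<Omega>"
  obtains b where "bounded_expfam vol h T b"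
proof -
  have cpt: "compact (UNIV :: 'a set)" and atl: "oriented_atlas atl" and sets: "sets vol = sets borel"
    using M unfolding closed_oriented_riemannian_manifold_def riemannian_volume_def by blast+
  have h: "smooth_map atl h" "\<And>x. h x > 0" and T: "smooth_map atl T"
    and pd: "positive_definite (expfam_cov vol h T \<theta>)"
    using fam \<theta> unfolding regular_minimal_expfam_def by blast+
  note cont_h = smooth_map_imp_continuous_on[OF atl h(1)]
    and cont_T = smooth_map_imp_continuous_on[OF atl T]
  have meas: "h \<in> borel_measurable vol" "T \<in> borel_measurable vol"
    using borel_measurable_continuous_onI[OF cont_h] borel_measurable_continuous_onI[OF cont_T]
    by (simp_all add: measurable_cong_sets[OF sets refl])
  obtain bh bT where bounds: "\<And>x. norm (h x) \<le> bh" "\<And>x. norm (T x) \<le> bT"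
    using compact_imp_bounded[OF compact_continuous_image[OF cont_h cpt]]
      compact_imp_bounded[OF compact_continuous_image[OF cont_T cpt]]
    unfolding bounded_iff by (metis rangeI)
  interpret finite_measure vol
    by (rule riemannian_volume_finite[OF M])
  have "bounded_expfam vol h T (max bh bT)"
  proof
    fix x
    show "h x \<le> max bh bT" "norm (T x) \<le> max bh bT"
      using bounds[of x] by auto
  qed (use meas h(2) positive_definite_cov_imp_nonnull[OF meas pd] in auto)
  then show ?thesis
    using that by blast
qed

lemma expfam_density_differentiable:
  assumes h: "smooth_map atl h" and T: "smooth_map atl T" and c: "c \<in> atl" "x \<in> chart_dom c"
  shows "(expfam_density vol h T \<theta> \<circ> chart_inv c) differentiable (at (coords c x))"
proof -
  obtain h' T' where
    h': "((\<lambda>y. h (chart_inv c y)) has_derivative h') (at (coords c x))" and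
    T': "((\<lambda>y. T (chart_inv c y)) has_derivative T') (at (coords c x))"
    using smooth_map_imp_differentiable[OF h c] smooth_map_imp_differentiable[OF T c]
    by (auto simp: differentiable_def o_def)
  show ?thesis
    unfolding o_def expfam_density_def
    by (rule differentiableI) (rule derivative_intros h' T')+
qed

text \<open>The Stein equations are tailored to the score \<open>T - m\<close> of the family: the weighted divergence of
  the velocity of \<open>\<beta>\<close> becomes the derivative of the density in the natural parameter direction \<open>\<beta>\<close>.\<close>

lemma divergence_covector_velocity:
  assumes M: "closed_oriented_riemannian_manifold atl g vol"
    and fam: "regular_minimal_expfam atl vol h T \<Omega>" and \<theta>: "\<theta> \<in> \<Omega>"
    and adm: "admissible_class atl Adm" and \<psi>: "\<And>j. \<psi> j \<in> Adm"
    and stein: "\<And>j. stein_operator atl g (expfam_density vol h T \<theta>) (\<psi> j) x =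
      - (T x $ j - expect_coord vol h T \<theta> $ j)"
  shows "divergence atl g (scale_field (expfam_density vol h T \<theta>) (covector_velocity \<psi> \<beta>)) x =
    expfam_density vol h T \<theta> x * (\<beta> \<bullet> (T x - expect_coord vol h T \<theta>))"
proof -
  have atl: "oriented_atlas atl" and g: "riemannian_metric atl g"
    using M unfolding closed_oriented_riemannian_manifold_def by blast+
  have h: "smooth_map atl h" "h x > 0" and T: "smooth_map atl T"
    using fam unfolding regular_minimal_expfam_def by blast+
  have fields: "differentiable_vector_field atl v" if "v \<in> Adm" for v
    using adm that unfolding admissible_class_def by blast
  have "divergence atl g (scale_field (expfam_density vol h T \<theta>) (covector_velocity \<psi> \<beta>)) x =
      expfam_density vol h T \<theta> x * stein_operator atl g (expfam_density vol h T \<theta>) (covector_velocity \<psi> \<beta>) x"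
    by (intro divergence_scale_field[OF atl g] fields admissible_class_covector_velocity[OF adm \<psi>]
        expfam_density_differentiable[OF h(1) T]) (use h(2) in \<open>simp_all add: expfam_density_def\<close>)
  also have "stein_operator atl g (expfam_density vol h T \<theta>) (covector_velocity \<psi> \<beta>) x =
      \<beta> \<bullet> (T x - expect_coord vol h T \<theta>)"
    by (simp add: stein_operator_covector_velocity[OF atl g fields[OF \<psi>]] stein inner_vec_def
        flip: sum_negf) (simp add: algebra_simps)
  finally show ?thesis .
qed

theorem theorem9p1:
  fixes atl :: "('m::{second_countable_topology, t2_space}, 'n::finite) chart set"
    and g :: "('m, 'n) metric_tensor"
    and vol :: "'m measure"
    and h :: "'m \<Rightarrow> real"
    and T :: "'m \<Rightarrow> real^'r::finite"
    and \<Omega> S :: "(real^'r) set"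
    and Adm :: "('m, 'n) vfield set"
    and \<psi> :: "real^'r \<Rightarrow> 'r \<Rightarrow> ('m, 'n) vfield"
    and J :: "real set"
    and \<eta> \<beta> :: "real \<Rightarrow> real^'r"
    and t :: real
  assumes manifold: "closed_oriented_riemannian_manifold atl g vol"
    and family: "regular_minimal_expfam atl vol h T \<Omega>"
    and adm: "admissible_class atl Adm"
    and S: "S \<subseteq> \<Omega>"
    and \<psi>_adm: "\<And>\<theta> j. \<theta> \<in> S \<Longrightarrow> \<psi> \<theta> j \<in> Adm"
    and stein: "\<And>\<theta> j x. \<theta> \<in> S \<Longrightarrow>
      stein_operator atl g (expfam_density vol h T \<theta>) (\<psi> \<theta> j) x
        = - (T x $ j - expect_coord vol h T \<theta> $ j)"
    and J: "is_interval J"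
    and curve: "\<eta> ` J \<subseteq> \<Omega>"
    and t: "t \<in> J" "\<eta> t \<in> S"
  shows "(continuity_equation_at atl g J (\<lambda>s. expfam_density vol h T (\<eta> s))
             (covector_velocity (\<psi> (\<eta> t)) (\<beta> t)) t
           \<longleftrightarrow> (\<eta> has_vector_derivative - \<beta> t) (at t within J))
       \<and> (continuity_equation_at atl g J (\<lambda>s. expfam_density vol h T (\<eta> s))
             (covector_velocity (\<psi> (\<eta> t)) (\<beta> t)) t
           \<longrightarrow> ((\<lambda>s. expect_coord vol h T (\<eta> s)) has_vector_derivative
                 - (expfam_cov vol h T (\<eta> t) *v \<beta> t)) (at t within J))"
proof -
  let ?q = "expfam_density vol h T" and ?m = "expect_coord vol h T"
  let ?continuity = "continuity_equation_at atl g J (\<lambda>s. ?q (\<eta> s)) (covector_velocity (\<psi> (\<eta> t)) (\<beta> t)) t"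
  have \<eta>t: "\<eta> t \<in> \<Omega>"
    using S t(2) by blast
  obtain b where "bounded_expfam vol h T b"
    by (rule regular_minimal_expfam_imp_bounded[OF manifold family \<eta>t])
  then interpret bounded_expfam vol h T b .
  have minimal: "positive_definite (expfam_cov vol h T (\<eta> t))"
    using family \<eta>t unfolding regular_minimal_expfam_def by blast
  have "- divergence atl g (scale_field (?q (\<eta> t)) (covector_velocity (\<psi> (\<eta> t)) (\<beta> t))) x =
      ?q (\<eta> t) x * (- \<beta> t \<bullet> (T x - ?m (\<eta> t)))" for x
    by (simp add: divergence_covector_velocity[OF manifold family \<eta>t adm \<psi>_adm[OF t(2)] stein[OF t(2)]])
  then have equiv: "?continuity \<longleftrightarrow> (\<eta> has_vector_derivative - \<beta> t) (at t within J)"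
    unfolding continuity_equation_at_def
    by (simp only: density_evolution_iff[where \<eta> = \<eta> and t = t, OF minimal])
  moreover have "((\<lambda>s. ?m (\<eta> s)) has_vector_derivative - (expfam_cov vol h T (\<eta> t) *v \<beta> t)) (at t within J)"
    if "(\<eta> has_vector_derivative - \<beta> t) (at t within J)"
    using expect_coord_has_vector_derivative[OF that]
    by (simp add: linear_neg[OF matrix_vector_mul_linear])
  ultimately show ?thesis
    by blast
qed

end
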